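(* If $L$ is a cyclically transitive linear order and $L'$ is a linear order cyclically equivalent to $L$, then $L'$ is cyclically transitive.
   Context: Linear orders may be empty. $L_1+L_2$ denotes the ordered sum (every element of $L_1$ strictly below every element of $L_2$); a partition $L=L_1+L_2$ means that $L_1$ is an initial segment of $L$ and $L_2$ is its complement (either may be empty). $L$ is cyclically transitive if for any $a\le b$ in $L$ there exist partitions $L=L_1+L_2=L_2'+L_1'$ with $a\in L_1$, $b\in L_1'$, and order isomorphisms $F_1:L_1\to L_1'$, $F_2:L_2\to L_2'$ satisfying $F_1(a)=b$. Linear orders $L,L'$ are cyclically equivalent if there are partitions $L=L_1+L_2$ and $L'=L_2'+L_1'$ with order isomorphisms $L_1\to L_1'$ and $L_2\to L_2'$. *)

theory Defs
  imports Main
begin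

text \<open>
  A linear order is a reflexive relation \<open>L\<close> with \<open>Linear_order L\<close>, its underlying set being
  \<open>Field L\<close>; the empty order is \<open>{}\<close>.  The suborder on \<open>A \<subseteq> Field L\<close> is \<open>Restr L A\<close>, whose field
  is \<open>A\<close> by reflexivity.  The constants \<open>ofilter\<close> (initial segment) and \<open>iso\<close> come from the
  well-order development of the library but are defined there for arbitrary relations; by
  \<open>iso_iff2\<close>, \<open>iso\<close> is order isomorphism (a bijection of the fields that preserves and reflects
  the relation).
\<close>

definition ordered_partition :: "'a rel \<Rightarrow> 'a set \<Rightarrow> 'a set \<Rightarrow> bool" where
  "ordered_partition L A B \<longleftrightarrow> Order_Relation.ofilter L A \<and> B = Field L - A"

lemma ordered_partition_iff:
  assumes "Linear_order L"
  shows "ordered_partition L A B \<longleftrightarrow>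
    A \<union> B = Field L \<and> A \<inter> B = {} \<and> (\<forall>a\<in>A. \<forall>b\<in>B. (a, b) \<in> L \<and> a \<noteq> b)"
    (is "?P \<longleftrightarrow> ?Q")
proof
  assume ?P
  then have A: "A \<subseteq> Field L" "\<And>a b. a \<in> A \<Longrightarrow> (b, a) \<in> L \<Longrightarrow> b \<in> A" and B: "B = Field L - A"
    by (auto simp: ordered_partition_def ofilter_def under_def)
  have "(a, b) \<in> L" if "a \<in> A" "b \<in> B" for a b
    using that A B Linear_order_in_diff_Id[OF assms, of a b] by blast
  with A B show ?Q by blast
next
  assume Q: ?Q
  have "b \<in> A" if ab: "a \<in> A" "(b, a) \<in> L" for a b
  proof (rule ccontr)
    assume "b \<notin> A"
    moreover have "b \<in> A \<union> B"
      using FieldI1[OF ab(2)] Q by simp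
    ultimately have "b \<in> B" by simp
    then have "(a, b) \<in> L" "a \<noteq> b"
      using ab(1) Q by simp_all
    moreover have "antisym L"
      using assms by (simp add: order_on_defs)
    ultimately show False
      using ab(2) by (metis antisymD)
  qed
  moreover have "A \<subseteq> Field L" "B = Field L - A"
    using Q by blast+
  ultimately show ?P
    unfolding ordered_partition_def ofilter_def under_def by blast
qed

definition cyclically_transitive :: "'a rel \<Rightarrow> bool" where
  "cyclically_transitive L \<longleftrightarrow>
    (\<forall>a b. (a, b) \<in> L \<longrightarrow>
      (\<exists>L1 L2 L1' L2' F1 F2.
        ordered_partition L L1 L2 \<and> ordered_partition L L2' L1' \<and>
        a \<in> L1 \<and> b \<in> L1' \<and>
        iso (Restr L L1) (Restr L L1') F1 \<and> iso (Restr L L2) (Restr L L2') F2 \<and>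
        F1 a = b))"

definition cyclically_equivalent :: "'a rel \<Rightarrow> 'b rel \<Rightarrow> bool" where
  "cyclically_equivalent L L' \<longleftrightarrow>
    (\<exists>L1 L2 L1' L2' F1 F2.
      ordered_partition L L1 L2 \<and> ordered_partition L' L2' L1' \<and>
      iso (Restr L L1) (Restr L' L1') F1 \<and> iso (Restr L L2) (Restr L' L2') F2)"

end

theory Submission
  imports Defs
begin

text \<open>
  A pair of crosswise isomorphic partitions is the same thing as a bijection that preserves the
  cyclic order (\<open>cyclic_iso_if_partition\<close>, \<open>partition_if_cyclic_iso\<close>), and such bijections compose
  and invert. Conjugating with an equivalence between \<open>L\<close> and \<open>L'\<close> thus yields, for \<open>a \<le> b\<close> in
  \<open>L'\<close>, a cyclic automorphism \<open>F\<close> of \<open>L'\<close> with \<open>F a = b\<close>. It remains to force \<open>a\<close> into the initial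
  segment of the partition. In the universal cover \<open>L' \<times> \<int>\<close>, lift \<open>F\<close> so that it sends \<open>(a, 0)\<close> to
  \<open>(b, 0)\<close>; the pointwise maximum of the lift and the identity is again an automorphism commuting
  with the shift, it still sends \<open>a\<close> to \<open>b\<close>, and it moves nothing downwards. If \<open>a\<close> was in
  the wrong segment, this maximum preserves \<open>L'\<close>, where it is the identity on the initial segment
  and \<open>max (F x) x\<close> on its complement (\<open>iso_max_id\<close>).
\<close>

section \<open>Cyclic orders and their isomorphisms\<close>

definition strict :: "'a rel \<Rightarrow> 'a \<Rightarrow> 'a \<Rightarrow> bool" where
  "strict L x y \<longleftrightarrow> (x, y) \<in> L \<and> x \<noteq> y"

text \<open>The ternary relation of the circle obtained by closing up \<open>L\<close>. It is
  invariant under rotating the three arguments and, for linear \<open>L\<close>, false when two of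
  them coincide.\<close>

definition cyclic :: "'a rel \<Rightarrow> 'a \<Rightarrow> 'a \<Rightarrow> 'a \<Rightarrow> bool" where
  "cyclic L x y z \<longleftrightarrow> strict L x y \<and> strict L y z \<or> strict L y z \<and> strict L z x \<or>
    strict L z x \<and> strict L x y"

definition cyclic_iso :: "'a rel \<Rightarrow> 'b rel \<Rightarrow> ('a \<Rightarrow> 'b) \<Rightarrow> bool" where
  "cyclic_iso L L' F \<longleftrightarrow> bij_betw F (Field L) (Field L') \<and>
    (\<forall>x\<in>Field L. \<forall>y\<in>Field L. \<forall>z\<in>Field L. cyclic L' (F x) (F y) (F z) \<longleftrightarrow> cyclic L x y z)"

lemma cyclic_iso_comp:
  assumes "cyclic_iso L M F" "cyclic_iso M N G"
  shows "cyclic_iso L N (G \<circ> F)"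
  using assms unfolding cyclic_iso_def
  by (auto intro: bij_betw_trans dest: bij_betwE)

lemma cyclic_iso_inv_into:
  assumes "cyclic_iso L M F"
  shows "cyclic_iso M L (inv_into (Field L) F)"
proof -
  have F: "bij_betw F (Field L) (Field M)"
    using assms by (simp add: cyclic_iso_def)
  have "F (inv_into (Field L) F x) = x" "inv_into (Field L) F x \<in> Field L" if "x \<in> Field M" for x
    using bij_betw_inv_into_right[OF F that] bij_betwE[OF bij_betw_inv_into[OF F]] that by auto
  then show ?thesis
    using assms bij_betw_inv_into[OF F] unfolding cyclic_iso_def by metis
qed

section \<open>Strict orders, partitions and isomorphisms of suborders\<close>

lemma strict_Field: "strict L x y \<Longrightarrow> x \<in> Field L \<and> y \<in> Field L"
  by (auto simp: strict_def Field_def)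

lemma strict_asym: "Linear_order L \<Longrightarrow> strict L x y \<Longrightarrow> \<not> strict L y x"
  by (auto simp: strict_def order_on_defs dest: antisymD)

lemma strict_trans: "Linear_order L \<Longrightarrow> strict L x y \<Longrightarrow> strict L y z \<Longrightarrow> strict L x z"
  unfolding strict_def order_on_defs by (metis antisymD transD)

lemma strict_total:
  "Linear_order L \<Longrightarrow> x \<in> Field L \<Longrightarrow> y \<in> Field L \<Longrightarrow> x = y \<or> strict L x y \<or> strict L y x"
  unfolding strict_def order_on_defs total_on_def by metis

lemma mem_iff_strict:
  "Linear_order L \<Longrightarrow> x \<in> Field L \<Longrightarrow> (x, y) \<in> L \<longleftrightarrow> x = y \<or> strict L x y"
  unfolding strict_def order_on_defs refl_on_def by metis

lemma ordered_partition_strict: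
  assumes "Linear_order L"
  shows "ordered_partition L A B \<longleftrightarrow>
    A \<union> B = Field L \<and> A \<inter> B = {} \<and> (\<forall>a\<in>A. \<forall>b\<in>B. strict L a b)"
  using ordered_partition_iff[OF assms] by (simp add: strict_def)

lemma iso_Restr_iff:
  assumes "Linear_order L" "Linear_order M" "A \<subseteq> Field L" "B \<subseteq> Field M"
  shows "iso (Restr L A) (Restr M B) F \<longleftrightarrow>
    bij_betw F A B \<and> (\<forall>x\<in>A. \<forall>y\<in>A. strict M (F x) (F y) \<longleftrightarrow> strict L x y)"
proof -
  have F: "Field (Restr L A) = A" "Field (Restr M B) = B"
    using assms by (simp_all add: Refl_Field_Restr2 order_on_defs)
  have "((x, y) \<in> L \<longleftrightarrow> (F x, F y) \<in> M) \<longleftrightarrow> (strict M (F x) (F y) \<longleftrightarrow> strict L x y)"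
    if "bij_betw F A B" "x \<in> A" "y \<in> A" for x y
  proof -
    have "F x = F y \<longleftrightarrow> x = y"
      using that by (auto simp: bij_betw_def inj_on_eq_iff)
    moreover have "F x \<in> Field M" "x \<in> Field L"
      using that assms bij_betwE by blast+
    ultimately show ?thesis
      using mem_iff_strict[OF assms(1)] mem_iff_strict[OF assms(2)] by (auto simp: strict_def)
  qed
  then show ?thesis
    unfolding iso_iff2 F by (intro conj_cong ball_cong refl) (simp add: bij_betw_apply)
qed

text \<open>By totality of \<open>L\<close>, strict monotonicity already yields injectivity and
  reflection of the order.\<close>

lemma iso_Restr_image:
  assumes L: "Linear_order L" and M: "Linear_order M" and A: "A \<subseteq> Field L" and B: "F ` A \<subseteq> Field M"
    and mono: "\<And>x y. x \<in> A \<Longrightarrow> y \<in> A \<Longrightarrow> strict L x y \<Longrightarrow> strict M (F x) (F y)"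
  shows "iso (Restr L A) (Restr M (F ` A)) F"
proof -
  have total: "x = y \<or> strict L x y \<or> strict L y x" if "x \<in> A" "y \<in> A" for x y
    using A strict_total[OF L] that by blast
  have "inj_on F A"
    using mono total unfolding inj_on_def by (metis strict_def)
  moreover have "strict L x y" if "x \<in> A" "y \<in> A" "strict M (F x) (F y)" for x y
    using that mono total strict_asym[OF M] by (metis strict_def)
  ultimately show ?thesis
    using mono by (auto simp: iso_Restr_iff[OF L M A B] bij_betw_def)
qed

section \<open>Crosswise isomorphic partitions and cyclic isomorphisms\<close>

text \<open>The glued map keeps the order within each part and reverses it between the parts. On a
  triple that meets both parts, this merely rotates the linear arrangement.\<close>

lemma cyclic_iso_if_partition:
  assumes L: "Linear_order L" and M: "Linear_order M"
    and P: "ordered_partition L A B" and Q: "ordered_partition M B' A'"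
    and F: "iso (Restr L A) (Restr M A') F" and G: "iso (Restr L B) (Restr M B') G"
  shows "cyclic_iso L M (\<lambda>x. if x \<in> A then F x else G x)" (is "cyclic_iso L M ?H")
proof -
  note P = P[unfolded ordered_partition_strict[OF L]]
  note Q = Q[unfolded ordered_partition_strict[OF M]]
  have sub: "A \<subseteq> Field L" "B \<subseteq> Field L" "A' \<subseteq> Field M" "B' \<subseteq> Field M"
    using P Q by auto
  note F = F[unfolded iso_Restr_iff[OF L M sub(1,3)]]
  note G = G[unfolded iso_Restr_iff[OF L M sub(2,4)]]
  have H: "?H x = F x" if "x \<in> A" for x using that by simp
  have H': "?H x = G x" "x \<notin> A" if "x \<in> B" for x using that P by auto
  have "bij_betw ?H A A'" "bij_betw ?H B B'"
    using F G H H' by (auto cong: bij_betw_cong)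
  then have "bij_betw ?H (A \<union> B) (A' \<union> B')"
    using Q by (intro bij_betw_combine) auto
  moreover have "A' \<union> B' = Field M" using Q by blast
  ultimately have bij: "bij_betw ?H (Field L) (Field M)" using P by simp
  have FA: "F x \<in> A'" if "x \<in> A" for x using F that bij_betwE by blast
  have GB: "G x \<in> B'" if "x \<in> B" for x using G that bij_betwE by blast
  have BA: "strict M (G y) (F x) \<and> \<not> strict M (F x) (G y) \<and> strict L x y \<and> \<not> strict L y x"
    if "x \<in> A" "y \<in> B" for x y
    using FA[OF that(1)] GB[OF that(2)] P Q that strict_asym[OF L] strict_asym[OF M] by blast
  have s: "strict M (?H x) (?H y) \<longleftrightarrow> (if x \<in> A \<longleftrightarrow> y \<in> A then strict L x y else strict L y x)"
    if "x \<in> Field L" "y \<in> Field L" for x y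
  proof -
    have "x \<in> B" if "x \<notin> A" using that P \<open>x \<in> Field L\<close> by blast
    moreover have "y \<in> B" if "y \<notin> A" using that P \<open>y \<in> Field L\<close> by blast
    ultimately show ?thesis
      using F G BA by (cases "x \<in> A"; cases "y \<in> A") simp_all
  qed
  \<comment> \<open>Mixed pairs are decided by membership in \<open>A\<close> alone, so cyclicity
    becomes a propositional check in eight cases.\<close>
  have s': "strict L x y \<longleftrightarrow> x \<in> A" if "x \<in> Field L" "y \<in> Field L" "(x \<in> A) \<noteq> (y \<in> A)" for x y
    using that P BA by blast
  have "cyclic M (?H x) (?H y) (?H z) \<longleftrightarrow> cyclic L x y z"
    if "x \<in> Field L" "y \<in> Field L" "z \<in> Field L" for x y z
    unfolding cyclic_def s[OF that(1,2)] s[OF that(2,3)] s[OF that(3,1)]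
    using s'[OF that(1,2)] s'[OF that(2,3)] s'[OF that(3,1)]
      s'[OF that(2,1)] s'[OF that(3,2)] s'[OF that(1,3)]
    by (cases "x \<in> A"; cases "y \<in> A"; cases "z \<in> A") simp_all
  then show ?thesis
    using bij unfolding cyclic_iso_def by blast
qed

text \<open>As a point climbs through \<open>L\<close>, its image goes round the circle of
  \<open>M\<close> once, hence drops past the bottom of \<open>M\<close> at most once. Cutting
  \<open>L\<close> at the drop gives the partition.\<close>

lemma partition_if_cyclic_iso:
  assumes L: "Linear_order L" and M: "Linear_order M" and F: "cyclic_iso L M F"
  obtains A B where "ordered_partition L A B" "ordered_partition M (F ` B) (F ` A)"
    "iso (Restr L A) (Restr M (F ` A)) F" "iso (Restr L B) (Restr M (F ` B)) F"
proof -
  \<comment> \<open>The points after the drop are those with a smaller point of larger image;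
    without a drop, \<open>B\<close> is empty.\<close>
  define B where "B = {y. \<exists>x. strict L x y \<and> strict M (F y) (F x)}"
  define A where "A = Field L - B"
  have bij: "bij_betw F (Field L) (Field M)"
    using F by (simp add: cyclic_iso_def)
  have inj: "F x = F y \<longleftrightarrow> x = y" if "x \<in> Field L" "y \<in> Field L" for x y
    using bij that by (auto simp: bij_betw_def inj_on_eq_iff)
  have FM: "F x \<in> Field M" if "x \<in> Field L" for x
    using bij that bij_betwE by blast
  have cyc: "cyclic M (F x) (F y) (F z) \<longleftrightarrow> cyclic L x y z"
    if "x \<in> Field L" "y \<in> Field L" "z \<in> Field L" for x y z
    using F that by (simp add: cyclic_iso_def)
  have tot: "strict M (F x) (F y) \<or> strict M (F y) (F x)" if "strict L x y" for x y
    using strict_total[OF M FM FM] inj strict_Field[OF that] that by (metis strict_def)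
  \<comment> \<open>Three increasing points never have images in the opposite orientation. Below,
    each contradiction from a witness \<open>u\<close> of membership in \<open>B\<close> exhibits
    such a triple.\<close>
  have no_reversal: False
    if "strict L x y" "strict L y z" "cyclic M (F x) (F z) (F y)" for x y z
  proof -
    have "cyclic L x z y" using cyc that strict_Field by metis
    then show False
      using that(1,2) strict_asym[OF L] strict_trans[OF L] unfolding cyclic_def by blast
  qed
  have BF: "B \<subseteq> Field L" unfolding B_def by (auto dest: strict_Field)
  have AB: "strict L x y" if "x \<in> A" "y \<in> B" for x y
  proof (rule ccontr)
    assume "\<not> strict L x y"
    then have yx: "strict L y x"
      using that BF strict_total[OF L, of x y] unfolding A_def by blast
    obtain u where u: "strict L u y" "strict M (F y) (F u)"
      using \<open>y \<in> B\<close> unfolding B_def by blast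
    have "strict M (F u) (F x)"
      using that(1) tot strict_trans[OF L u(1) yx] unfolding A_def B_def by blast
    then show False
      using no_reversal[OF u(1) yx] u(2) unfolding cyclic_def by blast
  qed
  have A: "strict M (F x) (F y)" if "x \<in> A" "y \<in> A" "strict L x y" for x y
    using that tot unfolding A_def B_def by blast
  have B: "strict M (F y) (F z)" if "y \<in> B" "z \<in> B" "strict L y z" for y z
  proof (rule ccontr)
    assume "\<not> strict M (F y) (F z)"
    then have "strict M (F z) (F y)" using tot that(3) by blast
    moreover obtain u where "strict L u y" "strict M (F y) (F u)"
      using \<open>y \<in> B\<close> unfolding B_def by blast
    ultimately show False
      using no_reversal that(3) unfolding cyclic_def by blast
  qed
  have BA: "strict M (F y) (F x)" if "x \<in> A" "y \<in> B" for x y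
  proof (rule ccontr)
    assume "\<not> strict M (F y) (F x)"
    then have xy: "strict M (F x) (F y)" using tot AB that by blast
    obtain u where u: "strict L u y" "strict M (F y) (F u)"
      using \<open>y \<in> B\<close> unfolding B_def by blast
    have xu: "strict M (F x) (F u)" using strict_trans[OF M xy u(2)] .
    \<comment> \<open>A point \<open>u\<close> below \<open>x\<close> with larger image would put
      \<open>x\<close> into \<open>B\<close>.\<close>
    then have "\<not> strict L u x" "u \<noteq> x"
      using that(1) strict_asym[OF M] unfolding A_def B_def by (blast, auto simp: strict_def)
    then have "strict L x u"
      using strict_total[OF L] strict_Field[OF u(1)] that(1) unfolding A_def by blast
    then show False
      using no_reversal u xy unfolding cyclic_def by blast
  qed
  have U: "A \<union> B = Field L" "A \<inter> B = {}" "A \<subseteq> Field L" using BF unfolding A_def by auto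
  have img: "F ` Field L = Field M" using bij by (simp add: bij_betw_def)
  then have FU: "F ` A \<subseteq> Field M" "F ` B \<subseteq> Field M" using U BF by auto
  show thesis
  proof
    show "ordered_partition L A B"
      using U AB unfolding ordered_partition_strict[OF L] by blast
    have "F ` B \<inter> F ` A = {}" using BA by (fastforce simp: strict_def)
    moreover have "F ` B \<union> F ` A = Field M"
      using img U(1) by (metis image_Un Un_commute)
    ultimately show "ordered_partition M (F ` B) (F ` A)"
      using BA unfolding ordered_partition_strict[OF M] by simp
    show "iso (Restr L A) (Restr M (F ` A)) F"
      using iso_Restr_image[OF L M U(3) FU(1)] A by blast
    show "iso (Restr L B) (Restr M (F ` B)) F"
      using iso_Restr_image[OF L M BF FU(2)] B by blast
  qed
qed

section \<open>The maximum of a partial isomorphism and the identity\<close>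

text \<open>Both \<open>F\<close> and the identity increase on the final segment \<open>B\<close>,
  hence so does their maximum; moving nothing down, it stays above the fixed points before
  \<open>B\<close>. Surjectivity rests on \<open>B'\<close> being initial.\<close>

lemma iso_max_id:
  assumes L: "Linear_order L"
    and P: "ordered_partition L A B" and Q: "ordered_partition L B' A'"
    and F: "iso (Restr L B) (Restr L B') F"
  shows "iso L L (\<lambda>x. if x \<in> B \<and> strict L x (F x) then F x else x)"
proof -
  define G where "G = (\<lambda>x. if x \<in> B \<and> strict L x (F x) then F x else x)"
  note P = P[unfolded ordered_partition_strict[OF L]]
  note Q = Q[unfolded ordered_partition_strict[OF L]]
  note asym = strict_asym[OF L] and trans = strict_trans[OF L] and total = strict_total[OF L]
  have sub: "B \<subseteq> Field L" "B' \<subseteq> Field L" using P Q by auto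
  note F = F[unfolded iso_Restr_iff[OF L L sub]]
  have FB: "F x \<in> B'" if "x \<in> B" for x using F that bij_betwE by blast
  have up: "y \<in> B" if "x \<in> B" "strict L x y" for x y
    using P that asym strict_Field[OF that(2)] by blast
  have down: "x \<in> B'" if "y \<in> B'" "strict L x y" for x y
    using Q that asym strict_Field[OF that(2)] by blast
  have mono: "strict L (G x) (G y)" if xy: "strict L x y" for x y
  proof -
    have up_y: "strict L x (F y)" if "strict L y (F y)" using trans xy that by blast
    show ?thesis
    proof (cases "x \<in> B")
      case True
      then have y: "y \<in> B" using up xy by blast
      then have Fxy: "strict L (F x) (F y)" using F True xy by blast
      have "y = F y \<or> strict L y (F y) \<or> strict L (F y) y"
        using total y FB sub by blast
      \<comment> \<open>If \<open>y\<close> stays fixed, then \<open>F x < F y \<le> y\<close>, so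
        \<open>G x\<close> is below \<open>y\<close> whichever value it takes.\<close>
      then have "strict L (F x) y" if "\<not> strict L y (F y)"
        using Fxy that trans by metis
      then show ?thesis using y xy up_y Fxy by (simp add: G_def)
    qed (use xy up_y in \<open>simp add: G_def\<close>)
  qed
  have mem: "G x \<in> Field L" if "x \<in> Field L" for x
    using that FB sub by (auto simp: G_def)
  have surj: "\<exists>x\<in>Field L. G x = y" if y: "y \<in> Field L" for y
  proof (cases "y \<in> B \<and> strict L y (F y)")
    \<comment> \<open>From \<open>y < F y\<close> and \<open>F y \<in> B'\<close> follows
      \<open>y \<in> B'\<close>, so \<open>y = F z\<close>. Now \<open>F z < F y\<close> forces
      \<open>z < y = F z\<close>, whence \<open>G z = y\<close>.\<close>
    case True
    then have "y \<in> B'" using FB down by blast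
    then obtain z where z: "z \<in> B" "F z = y"
      using F by (auto simp: bij_betw_def)
    then have "strict L z y" using F True by metis
    then show ?thesis using z sub by (auto simp: G_def)
  next
    case False
    then show ?thesis using y by (auto simp: G_def)
  qed
  have "G ` Field L = Field L"
    using mem surj by (auto simp: image_iff)
  then have "iso (Restr L (Field L)) (Restr L (Field L)) G"
    using iso_Restr_image[OF L L order_refl, of G] mono by auto
  then show ?thesis
    unfolding G_def Restr_Field .
qed

section \<open>Transfer along a cyclic equivalence\<close>

theorem corollary4p9:
  fixes L :: "'a rel" and L' :: "'b rel"
  assumes "Linear_order L" and "Linear_order L'"
    and "cyclically_transitive L"
    and "cyclically_equivalent L L'"
  shows "cyclically_transitive L'"
  unfolding cyclically_transitive_def
proof (intro allI impI)
  fix a b assume ab: "(a, b) \<in> L'"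
  note L = assms(1) and L' = assms(2)
  obtain H where H: "cyclic_iso L L' H"
    using assms(4) cyclic_iso_if_partition[OF L L'] unfolding cyclically_equivalent_def by blast
  let ?K = "inv_into (Field L) H"
  have bij: "bij_betw H (Field L) (Field L')"
    using H by (simp add: cyclic_iso_def)
  have F: "a \<in> Field L'" "b \<in> Field L'" using ab by (auto simp: Field_def)
  have K: "?K a \<in> Field L" "?K b \<in> Field L" "H (?K b) = b"
    using F bij_betwE[OF bij_betw_inv_into[OF bij]] bij_betw_inv_into_right[OF bij] by auto
  have rot: "\<exists>F. cyclic_iso L L F \<and> F x = y" if xy: "(x, y) \<in> L" for x y
  proof -
    obtain L1 L2 L1' L2' F1 F2 where P: "ordered_partition L L1 L2" "ordered_partition L L2' L1'"
        "iso (Restr L L1) (Restr L L1') F1" "iso (Restr L L2) (Restr L L2') F2"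
      and x: "x \<in> L1" "F1 x = y"
      using assms(3) xy unfolding cyclically_transitive_def by blast
    show ?thesis
      by (rule exI, rule conjI, rule cyclic_iso_if_partition[OF L L P]) (simp add: x)
  qed
  \<comment> \<open>\<open>?K\<close> preserves only the cyclic order, so the preimages may come in
    either order; in the reversed case the automorphism of \<open>L\<close> is inverted.\<close>
  have "(?K a, ?K b) \<in> L \<or> (?K b, ?K a) \<in> L"
    using K strict_total[OF L] mem_iff_strict[OF L] by metis
  then obtain R where R: "cyclic_iso L L R" "R (?K a) = ?K b"
  proof
    assume "(?K b, ?K a) \<in> L"
    then obtain S where S: "cyclic_iso L L S" "S (?K b) = ?K a" using rot by blast
    then have "inv_into (Field L) S (?K a) = ?K b"
      using K bij_betw_inv_into_left unfolding cyclic_iso_def by metis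
    then show thesis using that cyclic_iso_inv_into[OF S(1)] by blast
  qed (use rot that in blast)
  define G where "G = H \<circ> (R \<circ> ?K)"
  have "cyclic_iso L' L' G"
    unfolding G_def by (rule cyclic_iso_comp[OF cyclic_iso_comp[OF cyclic_iso_inv_into[OF H] R(1)] H])
  then obtain A B where P: "ordered_partition L' A B" "ordered_partition L' (G ` B) (G ` A)"
    "iso (Restr L' A) (Restr L' (G ` A)) G" "iso (Restr L' B) (Restr L' (G ` B)) G"
    using partition_if_cyclic_iso[OF L' L'] by blast
  have Gab: "G a = b" using R K unfolding G_def by simp
  show "\<exists>L1 L2 L1' L2' F1 F2. ordered_partition L' L1 L2 \<and> ordered_partition L' L2' L1' \<and>
    a \<in> L1 \<and> b \<in> L1' \<and> iso (Restr L' L1) (Restr L' L1') F1 \<and>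
    iso (Restr L' L2) (Restr L' L2') F2 \<and> F1 a = b"
  proof (cases "a \<in> A")
    case True
    then show ?thesis using P Gab by blast
  next
    case False
    then have a: "a \<in> B" using P(1) F unfolding ordered_partition_def by blast
    define M where "M = (\<lambda>x. if x \<in> B \<and> strict L' x (G x) then G x else x)"
    have "iso (Restr L' (Field L')) (Restr L' (Field L')) M"
      unfolding M_def Restr_Field using iso_max_id[OF L' P(1,2,4)] .
    \<comment> \<open>This includes \<open>a = b\<close>: then the strict test fails and
      \<open>M a = a\<close>.\<close>
    moreover have "M a = b" using a Gab ab by (simp add: M_def strict_def)
    \<comment> \<open>\<open>M\<close> is an automorphism of all of \<open>L'\<close>, so both
      partitions are taken trivial, with \<open>L'\<close> as the part containing \<open>a\<close>
      and \<open>b\<close>.\<close>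
    moreover have "iso (Restr L' {}) (Restr L' {}) id" by (simp add: iso_iff2)
    moreover have "ordered_partition L' (Field L') {}" "ordered_partition L' {} (Field L')"
      unfolding ordered_partition_strict[OF L'] by auto
    ultimately show ?thesis using F by blast
  qed
qed

end
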